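(* Let $n$ be a positive integer. If $\mathcal{G}$ is any finite group of (invertible) $n\times n$-matrices over $\mathbb{C}$ such that $\operatorname{trace}(g)\in\mathbb{Q}$ holds for all $g\in\mathcal{G}$, then the order $|\mathcal{G}|$ divides $$M(n)=\prod_{p} p^{\left\lfloor \frac{n}{p-1}\right\rfloor+\left\lfloor \frac{n}{p(p-1)}\right\rfloor+\left\lfloor \frac{n}{p^2(p-1)}\right\rfloor+\cdots},$$ where $p$ runs over all primes.
   Context: $\lfloor x\rfloor$ denotes the greatest integer less than or equal to $x$. The product defining $M(n)$ is finite because the factor for $p$ equals $1$ whenever $p>n+1$. A finite group of $n\times n$-matrices over $\mathbb{C}$ means a finite subgroup of $\mathrm{GL}_n(\mathbb{C})$. *)

theory Defs
  imports
    "Jordan_Normal_Form.Matrix"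
    "HOL-Computational_Algebra.Primes"
    Complex_Main
begin

definition GL :: "nat \<Rightarrow> complex mat monoid" where
  "GL n = units_of (ring_mat TYPE(complex) n ())"

definition mat_trace :: "complex mat \<Rightarrow> complex" where
  "mat_trace A = (\<Sum>i<dim_row A. A $$ (i, i))"

text \<open>
  On natural numbers, \<open>div\<close> is the floor of the quotient.  The series below has only finitely
  many nonzero terms (see \<open>schur_exponent_finite\<close>), so \<open>suminf\<close> is its actual value.
\<close>

definition schur_exponent :: "nat \<Rightarrow> nat \<Rightarrow> nat" where
  "schur_exponent n p = (\<Sum>k. n div (p ^ k * (p - 1)))"

text \<open>
  \<open>prod\<close> over an infinite set is \<open>1\<close> by convention, so the product over all primes is
  cut off at \<open>n + 1\<close>; by \<open>schur_exponent_eq_0\<close> the omitted factors are all \<open>1\<close>.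
\<close>

definition schur_bound :: "nat \<Rightarrow> nat" where
  "schur_bound n = (\<Prod>p | prime p \<and> p \<le> n + 1. p ^ schur_exponent n p)"

lemma schur_exponent_finite:
  assumes "prime p"
  shows "(\<lambda>k. n div (p ^ k * (p - 1))) sums (\<Sum>k<n. n div (p ^ k * (p - 1)))"
    and "schur_exponent n p = (\<Sum>k<n. n div (p ^ k * (p - 1)))"
proof -
  have p: "2 \<le> p" using assms by (rule prime_ge_2_nat)
  have "n div (p ^ k * (p - 1)) = 0" if "k \<notin> {..<n}" for k
  proof -
    have "n \<le> k" using that by simp
    also have "k < p ^ k" using p by (intro less_exp[THEN order.strict_trans2] power_mono) auto
    also have "\<dots> \<le> p ^ k * (p - 1)" using p by simp
    finally show ?thesis by simp
  qed
  then show s: "(\<lambda>k. n div (p ^ k * (p - 1))) sums (\<Sum>k<n. n div (p ^ k * (p - 1)))"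
    by (intro sums_finite) auto
  then show "schur_exponent n p = (\<Sum>k<n. n div (p ^ k * (p - 1)))"
    unfolding schur_exponent_def by (simp add: sums_unique[symmetric])
qed

lemma schur_exponent_eq_0:
  assumes "n + 1 < p"
  shows "schur_exponent n p = 0"
proof -
  have "n div (p ^ k * (p - 1)) = 0" for k
  proof -
    have "n < p - 1" using assms by simp
    also have "\<dots> \<le> p ^ k * (p - 1)" using assms by simp
    finally show ?thesis by simp
  qed
  then show ?thesis by (simp add: schur_exponent_def)
qed

lemma carrier_GL:
  "carrier (GL n) =
    {A \<in> carrier_mat n n. \<exists>B \<in> carrier_mat n n. B * A = 1\<^sub>m n \<and> A * B = 1\<^sub>m n}"
  by (simp add: GL_def units_of_def Units_def ring_mat_def)

lemma mult_GL: "x \<otimes>\<^bsub>GL n\<^esub> y = x * y" and one_GL: "\<one>\<^bsub>GL n\<^esub> = 1\<^sub>m n"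
  by (simp_all add: GL_def units_of_def ring_mat_def)

lemma group_GL: "group (GL n)"
proof -
  interpret ring "ring_mat TYPE(complex) n ()" by (rule ring_mat)
  show ?thesis unfolding GL_def by (rule units_group)
qed

end

theory Submission
  imports
    Defs
    "Jordan_Normal_Form.Schur_Decomposition"
    "HOL-Algebra.Sylow"
    "HOL-Algebra.Multiplicative_Group"
begin

text \<open>
  This is Schur's argument. By Sylow's theorem it suffices to bound the order \<open>p ^ a\<close> of a
  \<open>p\<close>-subgroup \<open>P\<close>. The matrices of \<open>P\<close> have very few possible traces: with
  \<open>N = n div (p - 1)\<close>, every trace has the form \<open>n - p * j\<close> with \<open>0 \<le> j \<le> N\<close>, and \<open>j = 0\<close> only for
  the identity (\<open>p_element_rational_trace\<close>). Hence the integer polynomial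
  \<open>f x = (\<Prod>j=1..N. x - (n - p * j))\<close> takes the value \<open>p ^ N * N!\<close> at the trace of the identity and
  vanishes at the traces of all other elements, so that the sum of \<open>f (trace g)\<close> over \<open>P\<close> equals
  \<open>p ^ N * N!\<close>. On the other hand this sum is a multiple of \<open>p ^ a\<close>, because the average of each
  power of the trace is the dimension of the space of invariants in a tensor power
  (\<open>card_dvd_sum_trace_power\<close>). So \<open>p ^ a\<close> divides \<open>p ^ N * N!\<close>, and Legendre's formula for the
  exponent of \<open>p\<close> in \<open>N!\<close> turns this into the claimed exponent.

  The shape of the traces comes from Galois theory in an elementary guise. The trace of \<open>g\<close> is
  \<open>\<Sum>i<q. c i * \<zeta> ^ i\<close>, where \<open>q\<close> is a power of \<open>p\<close>, \<open>\<zeta>\<close> is a primitive \<open>q\<close>-th root of unity, and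
  \<open>c i\<close> is the multiplicity of the eigenvalue \<open>\<zeta> ^ i\<close>. The only rational relations among the powers
  of \<open>\<zeta>\<close> come from \<open>1 + \<zeta> ^ m + \<dots> + \<zeta> ^ ((p - 1) * m) = 0\<close> with \<open>m = q / p\<close>
  (\<open>cyclotomic_powers_independent\<close>), so that rationality of the trace forces \<open>c\<close> to be constant on
  the residue classes modulo \<open>m\<close>, apart from the value \<open>c 0\<close>. Counting the eigenvalues by residue
  class gives the form \<open>n - p * j\<close> and the bound on \<open>j\<close>.
\<close>

hide_const (open) UnivPoly.coeff UnivPoly.monom

section \<open>Traces of idempotent matrices and of invariant sums\<close>

lemma mat_trace_eq: "A \<in> carrier_mat n n \<Longrightarrow> mat_trace A = (\<Sum>i<n. A $$ (i, i))"
  by (simp add: mat_trace_def)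

lemma index_mult_mat_sum:
  assumes "A \<in> carrier_mat n n" "B \<in> carrier_mat n n" "i < n" "j < n"
  shows "(A * B) $$ (i, j) = (\<Sum>k<n. A $$ (i, k) * B $$ (k, j))"
  using assms by (simp add: scalar_prod_def atLeast0LessThan)

lemma mat_trace_mult_comm:
  assumes "A \<in> carrier_mat n n" "B \<in> carrier_mat n n"
  shows "mat_trace (A * B) = mat_trace (B * A)"
proof -
  have "mat_trace (A * B) = (\<Sum>i<n. \<Sum>k<n. A $$ (i, k) * B $$ (k, i))"
    using assms by (simp add: mat_trace_eq[of _ n] index_mult_mat_sum[of _ n] del: index_mult_mat)
  also have "\<dots> = (\<Sum>k<n. \<Sum>i<n. B $$ (k, i) * A $$ (i, k))"
    by (subst sum.swap) (simp add: mult.commute)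
  also have "\<dots> = mat_trace (B * A)"
    using assms by (simp add: mat_trace_eq[of _ n] index_mult_mat_sum[of _ n] del: index_mult_mat)
  finally show ?thesis .
qed

lemma mat_trace_one: "mat_trace (1\<^sub>m n) = of_nat n"
  by (simp add: mat_trace_def)

lemma mat_trace_smult: "A \<in> carrier_mat n n \<Longrightarrow> mat_trace (c \<cdot>\<^sub>m A) = c * mat_trace A"
  by (simp add: mat_trace_eq[of _ n] sum_distrib_left)

text \<open>
  A strictly upper triangular matrix is nilpotent, and a nilpotent idempotent vanishes. The proof
  is an induction on the distance \<open>j - i\<close> from the diagonal, since every product contributing to the
  entry \<open>(i, j)\<close> of \<open>T * T\<close> contains an entry closer to the diagonal.
\<close>

lemma upper_triangular_idempotent_eq_0:
  assumes T: "(T :: complex mat) \<in> carrier_mat n n" and ut: "upper_triangular T" and idem: "T * T = T"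
    and diag: "\<And>i. i < n \<Longrightarrow> T $$ (i, i) = 0"
  shows "T = 0\<^sub>m n n"
proof -
  have low: "T $$ (i, j) = 0" if "j \<le> i" "i < n" for i j
    using that ut T diag by (cases "j = i") (auto simp: upper_triangular_def)
  have "T $$ (i, j) = 0" if "i < n" "j < n" for i j
    using that
  proof (induction "j - i" arbitrary: i j rule: less_induct)
    case less
    show ?case
    proof (cases "i < j")
      case True
      have "T $$ (i, j) = (T * T) $$ (i, j)" by (simp add: idem)
      also have "\<dots> = (\<Sum>k<n. T $$ (i, k) * T $$ (k, j))"
        using T less.prems by (intro index_mult_mat_sum)
      also have "\<dots> = 0"
      proof (intro sum.neutral ballI)
        fix k assume k: "k \<in> {..<n}"
        show "T $$ (i, k) * T $$ (k, j) = 0"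
        proof (cases "i < k \<and> k < j")
          case True
          then have "k - i < j - i" by arith
          then show ?thesis using less.hyps[of k i] k less.prems by simp
        next
          case False
          then show ?thesis using low[of k i] low[of j k] k less.prems by auto
        qed
      qed
      finally show ?thesis .
    qed (use low less.prems in auto)
  qed
  then show ?thesis using T by (intro eq_matI) auto
qed

text \<open>
  The number \<open>r\<close> is the rank of \<open>E\<close>. It is found by triangularising \<open>E\<close>: the diagonal entries of an
  idempotent triangular matrix are \<open>0\<close> or \<open>1\<close>, and their sum is the trace.
\<close>

lemma idempotent_mat_trace:
  assumes E: "E \<in> carrier_mat n n" and idem: "E * E = E"
  obtains r :: nat where "mat_trace E = of_nat r" and "r = 0 \<Longrightarrow> E = 0\<^sub>m n n"
proof -
  obtain as where "char_poly E = (\<Prod>a\<leftarrow>as. [:- a, 1:])"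
    using char_poly_factorized[OF E] by blast
  then obtain T where T: "T \<in> carrier_mat n n" "upper_triangular T" "similar_mat E T"
    using schur_decomposition_exists[OF E] by blast
  from similar_matD[OF T(3)] obtain m P Q where
    "{E, T, P, Q} \<subseteq> carrier_mat m m" "P * Q = 1\<^sub>m m" "Q * P = 1\<^sub>m m" "E = P * T * Q"
    by blast
  moreover from this E have "m = n" by auto
  ultimately have P: "P \<in> carrier_mat n n" "Q \<in> carrier_mat n n" "Q * P = 1\<^sub>m n" and
    ET: "E = P * T * Q" by auto
  have "T = (Q * P) * T * (Q * P)" using T P(3) by simp
  also have "\<dots> = Q * E * P"
    unfolding ET using T P(1,2) by (simp add: assoc_mult_mat[of _ n n _ n _ n])
  finally have TE: "T = Q * E * P" .
  have "T * T = Q * E * (P * Q) * E * P"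
    unfolding TE using E P(1,2) by (simp add: assoc_mult_mat[of _ n n _ n _ n])
  also have "P * Q = 1\<^sub>m n"
    using mat_mult_left_right_inverse[OF P(2,1,3)] .
  also have "Q * E * 1\<^sub>m n * E * P = Q * (E * E) * P"
    using E P(1,2) by (simp add: assoc_mult_mat[of _ n n _ n _ n])
  finally have TT: "T * T = T" unfolding idem TE[symmetric] .
  have d: "T $$ (i, i) = 0 \<or> T $$ (i, i) = 1" if i: "i < n" for i
  proof -
    have "T $$ (i, k) * T $$ (k, i) = 0" if "k < n" "k \<noteq> i" for k
      using that T i nat_neq_iff[of k i] by (auto simp: upper_triangular_def)
    then have off: "k \<in> {..<n} \<Longrightarrow> k \<noteq> i \<Longrightarrow> T $$ (i, k) * T $$ (k, i) = 0" for k by simp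
    have "T $$ (i, i) = (\<Sum>k<n. T $$ (i, k) * T $$ (k, i))"
      using index_mult_mat_sum[OF T(1) T(1) i i] by (simp add: TT)
    also have "\<dots> = (\<Sum>k<n. if k = i then T $$ (i, i) * T $$ (i, i) else 0)"
      using off by (intro sum.cong refl) simp
    also have "\<dots> = T $$ (i, i) * T $$ (i, i)" using i by simp
    finally show ?thesis by simp
  qed
  define R where "R = {i. i < n \<and> T $$ (i, i) = 1}"
  have "mat_trace E = mat_trace (Q * (P * T))"
    unfolding ET using T P by (intro mat_trace_mult_comm) auto
  also have "Q * (P * T) = T" using T P by (simp add: assoc_mult_mat[of _ n n _ n _ n, symmetric])
  also have "mat_trace T = (\<Sum>i<n. if i \<in> R then 1 else 0)"
    unfolding mat_trace_eq[OF T(1)] R_def using d by (intro sum.cong) auto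
  also have "\<dots> = of_nat (card R)" by (simp add: R_def sum.If_cases Int_def)
  finally have tr: "mat_trace E = of_nat (card R)" .
  have "E = 0\<^sub>m n n" if "card R = 0"
  proof -
    have "R = {}" using that by (simp add: R_def)
    then have "T = 0\<^sub>m n n"
      using d by (intro upper_triangular_idempotent_eq_0 T TT) (auto simp: R_def)
    then show ?thesis unfolding ET using P by simp
  qed
  with tr show ?thesis by (rule that)
qed

text \<open>
  Matrices of unspecified size do not form an additive monoid, so the dimension is passed
  explicitly and the sum is formed entrywise.
\<close>

definition sum_mats :: "nat \<Rightarrow> ('a \<Rightarrow> complex mat) \<Rightarrow> 'a set \<Rightarrow> complex mat" where
  "sum_mats n \<rho> I = mat n n (\<lambda>(i, j). \<Sum>a\<in>I. \<rho> a $$ (i, j))"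

lemma sum_mats_carrier [simp]: "sum_mats n \<rho> I \<in> carrier_mat n n"
  by (simp add: sum_mats_def)

lemma sum_mats_cong:
  "I = J \<Longrightarrow> (\<And>a. a \<in> J \<Longrightarrow> \<rho> a = \<sigma> a) \<Longrightarrow> sum_mats n \<rho> I = sum_mats n \<sigma> J"
  by (simp add: sum_mats_def)

lemma mat_trace_sum_mats:
  assumes "\<And>a. a \<in> I \<Longrightarrow> \<rho> a \<in> carrier_mat n n"
  shows "mat_trace (sum_mats n \<rho> I) = (\<Sum>a\<in>I. mat_trace (\<rho> a))"
proof -
  have "mat_trace (sum_mats n \<rho> I) = (\<Sum>i<n. \<Sum>a\<in>I. \<rho> a $$ (i, i))"
    by (simp add: mat_trace_def sum_mats_def)
  also have "\<dots> = (\<Sum>a\<in>I. mat_trace (\<rho> a))"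
    by (subst sum.swap) (simp add: mat_trace_eq[OF assms])
  finally show ?thesis .
qed

lemma mult_sum_mats:
  assumes "A \<in> carrier_mat n n" "\<And>a. a \<in> I \<Longrightarrow> \<rho> a \<in> carrier_mat n n"
  shows "A * sum_mats n \<rho> I = sum_mats n (\<lambda>a. A * \<rho> a) I" (is "?L = ?R")
proof (rule eq_matI)
  fix i j assume "i < dim_row ?R" "j < dim_col ?R"
  then have ij: "i < n" "j < n" by (simp_all add: sum_mats_def)
  have "?L $$ (i, j) = (\<Sum>k<n. \<Sum>a\<in>I. A $$ (i, k) * \<rho> a $$ (k, j))"
    using assms ij by (simp add: index_mult_mat_sum[of _ n] del: index_mult_mat) (simp add: sum_mats_def sum_distrib_left)
  also have "\<dots> = ?R $$ (i, j)"
    using assms ij by (subst sum.swap) (simp add: sum_mats_def index_mult_mat_sum[of _ n] del: index_mult_mat)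
  finally show "?L $$ (i, j) = ?R $$ (i, j)" .
qed (use assms in \<open>auto simp: sum_mats_def\<close>)

lemma sum_mats_mult:
  assumes "A \<in> carrier_mat n n" "\<And>a. a \<in> I \<Longrightarrow> \<rho> a \<in> carrier_mat n n"
  shows "sum_mats n \<rho> I * A = sum_mats n (\<lambda>a. \<rho> a * A) I" (is "?L = ?R")
proof (rule eq_matI)
  fix i j assume "i < dim_row ?R" "j < dim_col ?R"
  then have ij: "i < n" "j < n" by (simp_all add: sum_mats_def)
  have "?L $$ (i, j) = (\<Sum>k<n. \<Sum>a\<in>I. \<rho> a $$ (i, k) * A $$ (k, j))"
    using assms ij by (simp add: index_mult_mat_sum[of _ n] del: index_mult_mat) (simp add: sum_mats_def sum_distrib_right)
  also have "\<dots> = ?R $$ (i, j)"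
    using assms ij by (subst sum.swap) (simp add: sum_mats_def index_mult_mat_sum[of _ n] del: index_mult_mat)
  finally show "?L $$ (i, j) = ?R $$ (i, j)" .
qed (use assms in \<open>auto simp: sum_mats_def\<close>)

lemma sum_mats_reindex:
  "bij_betw h I J \<Longrightarrow> sum_mats n (\<lambda>a. \<rho> (h a)) I = sum_mats n \<rho> J"
  unfolding sum_mats_def by (intro arg_cong[where f = "mat n n"] ext) (auto intro: sum.reindex_bij_betw)

text \<open>
  If the sum absorbs every summand, then dividing it by the number of summands gives an
  idempotent, the projection onto the common fixed vectors. This single fact yields both the
  divisibility of power sums of characters and the multiplicities of eigenvalues.
\<close>

lemma invariant_sum_mats_trace:
  assumes I: "finite I" "I \<noteq> {}" and \<rho>: "\<And>a. a \<in> I \<Longrightarrow> \<rho> a \<in> carrier_mat n n"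
    and inv: "\<And>a. a \<in> I \<Longrightarrow> sum_mats n \<rho> I * \<rho> a = sum_mats n \<rho> I"
  obtains r :: nat where "(\<Sum>a\<in>I. mat_trace (\<rho> a)) = of_nat (card I) * of_nat r"
    and "r = 0 \<Longrightarrow> sum_mats n \<rho> I = 0\<^sub>m n n"
proof -
  define S where "S = sum_mats n \<rho> I"
  define c :: complex where "c = of_nat (card I)"
  have c: "c \<noteq> 0" using I by (simp add: c_def)
  have S: "S \<in> carrier_mat n n" by (simp add: S_def)
  have "S * S = sum_mats n (\<lambda>a. S * \<rho> a) I"
    unfolding S_def by (intro mult_sum_mats \<rho>) auto
  also have "\<dots> = sum_mats n (\<lambda>a. S) I"
    using inv by (intro sum_mats_cong) (auto simp: S_def)
  also have "\<dots> = c \<cdot>\<^sub>m S"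
    using S by (intro eq_matI) (auto simp: sum_mats_def c_def)
  finally have SS: "S * S = c \<cdot>\<^sub>m S" .
  define E where "E = (1 / c) \<cdot>\<^sub>m S"
  have E: "E \<in> carrier_mat n n" using S by (simp add: E_def)
  have "E * E = (1 / c) \<cdot>\<^sub>m ((1 / c) \<cdot>\<^sub>m (S * S))"
    unfolding E_def using S by (simp add: mult_smult_assoc_mat[of _ n n _ n] mult_smult_distrib[of _ n n _ n])
  also have "\<dots> = E" unfolding SS E_def using c S by (intro eq_matI) auto
  finally obtain r where r: "mat_trace E = of_nat r" "r = 0 \<Longrightarrow> E = 0\<^sub>m n n"
    using idempotent_mat_trace[OF E] by blast
  have SE: "S = c \<cdot>\<^sub>m E" unfolding E_def using c S by (intro eq_matI) auto
  have "(\<Sum>a\<in>I. mat_trace (\<rho> a)) = mat_trace S"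
    unfolding S_def by (rule mat_trace_sum_mats[OF \<rho>, symmetric])
  also have "\<dots> = c * of_nat r"
    unfolding SE mat_trace_smult[OF E] r ..
  finally have "(\<Sum>a\<in>I. mat_trace (\<rho> a)) = of_nat (card I) * of_nat r" unfolding c_def .
  moreover have "sum_mats n \<rho> I = 0\<^sub>m n n" if "r = 0"
    using r(2)[OF that] unfolding S_def[symmetric] SE by simp
  ultimately show ?thesis by (rule that)
qed

section \<open>Power sums of traces over a finite matrix group\<close>

lemma sum_lessThan_mult:
  fixes f :: "nat \<Rightarrow> 'a :: comm_monoid_add"
  shows "(\<Sum>k<a * b. f k) = (\<Sum>x<a. \<Sum>y<b. f (x * b + y))"
proof -
  have "(\<Sum>k\<in>{x * b..<x * b + b}. f k) = (\<Sum>y<b. f (x * b + y))" for x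
    using sum.shift_bounds_nat_ivl[of f 0 "x * b" b]
    by (simp add: atLeast0LessThan add.commute)
  then show ?thesis by (simp add: sum.nat_group[symmetric])
qed

definition kronecker :: "complex mat \<Rightarrow> complex mat \<Rightarrow> complex mat" where
  "kronecker A B = mat (dim_row A * dim_row B) (dim_col A * dim_col B)
    (\<lambda>(i, j). A $$ (i div dim_row B, j div dim_col B) * B $$ (i mod dim_row B, j mod dim_col B))"

lemma kronecker_carrier:
  "A \<in> carrier_mat a a \<Longrightarrow> B \<in> carrier_mat b b \<Longrightarrow> kronecker A B \<in> carrier_mat (a * b) (a * b)"
  by (auto simp: kronecker_def)

lemma div_mod_less_mult:
  assumes "i < a * (b :: nat)" shows "i div b < a" "i mod b < b"
proof -
  show "i div b < a" using assms by (simp add: less_mult_imp_div_less)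
  have "b > 0" using assms by (cases b) auto
  then show "i mod b < b" by simp
qed

text \<open>
  An index below \<open>a * b\<close> stands for a pair via quotient and remainder modulo \<open>b\<close>, so that the sum
  over the intermediate index factors into two independent sums.
\<close>

lemma kronecker_mult:
  assumes A: "A \<in> carrier_mat a a" "C \<in> carrier_mat a a"
    and B: "B \<in> carrier_mat b b" "D \<in> carrier_mat b b"
  shows "kronecker (A * C) (B * D) = kronecker A B * kronecker C D" (is "?L = ?R")
proof (rule eq_matI)
  note kr = kronecker_carrier[OF A(1) B(1)] kronecker_carrier[OF A(2) B(2)]
  fix i j assume "i < dim_row ?R" "j < dim_col ?R"
  then have ij: "i < a * b" "j < a * b" using kr by auto
  note dm = div_mod_less_mult[OF ij(1)] div_mod_less_mult[OF ij(2)]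
  have "?R $$ (i, j) = (\<Sum>k<a * b. kronecker A B $$ (i, k) * kronecker C D $$ (k, j))"
    by (rule index_mult_mat_sum[OF kr ij])
  also have "\<dots> = (\<Sum>x<a. \<Sum>y<b. kronecker A B $$ (i, x * b + y) * kronecker C D $$ (x * b + y, j))"
    by (rule sum_lessThan_mult)
  also have "\<dots> = (\<Sum>x<a. \<Sum>y<b. (A $$ (i div b, x) * C $$ (x, j div b)) * (B $$ (i mod b, y) * D $$ (y, j mod b)))"
  proof (intro sum.cong refl)
    fix x y assume xy: "x \<in> {..<a}" "y \<in> {..<b}"
    have "x * b + y < Suc x * b" using xy by simp
    also have "\<dots> \<le> a * b" using xy by (intro mult_le_mono1) simp
    finally have "x * b + y < a * b" .
    then show "kronecker A B $$ (i, x * b + y) * kronecker C D $$ (x * b + y, j) =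
        (A $$ (i div b, x) * C $$ (x, j div b)) * (B $$ (i mod b, y) * D $$ (y, j mod b))"
      using A B ij xy by (simp add: kronecker_def)
  qed
  also have "\<dots> = (A * C) $$ (i div b, j div b) * (B * D) $$ (i mod b, j mod b)"
    using dm A B by (simp only: index_mult_mat_sum[of _ a] index_mult_mat_sum[of _ b] sum_product)
  also have "\<dots> = ?L $$ (i, j)"
    using A B ij by (simp add: kronecker_def)
  finally show "?L $$ (i, j) = ?R $$ (i, j)" ..
qed (use A B in \<open>auto simp: kronecker_def\<close>)

lemma mat_trace_kronecker:
  assumes A: "A \<in> carrier_mat a a" and B: "B \<in> carrier_mat b b"
  shows "mat_trace (kronecker A B) = mat_trace A * mat_trace B"
proof -
  have "mat_trace (kronecker A B) = (\<Sum>x<a. \<Sum>y<b. kronecker A B $$ (x * b + y, x * b + y))"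
    by (simp add: mat_trace_eq[OF kronecker_carrier[OF A B]] sum_lessThan_mult)
  also have "\<dots> = (\<Sum>x<a. \<Sum>y<b. A $$ (x, x) * B $$ (y, y))"
  proof (intro sum.cong refl)
    fix x y assume xy: "x \<in> {..<a}" "y \<in> {..<b}"
    have "x * b + y < Suc x * b" using xy by simp
    also have "\<dots> \<le> a * b" using xy by (intro mult_le_mono1) simp
    finally have "x * b + y < a * b" .
    then show "kronecker A B $$ (x * b + y, x * b + y) = A $$ (x, x) * B $$ (y, y)"
      using A B xy by (simp add: kronecker_def)
  qed
  finally show ?thesis by (simp add: mat_trace_eq[OF A] mat_trace_eq[OF B] sum_product)
qed

fun tensor_power :: "complex mat \<Rightarrow> nat \<Rightarrow> complex mat" where
  "tensor_power A 0 = 1\<^sub>m 1"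
| "tensor_power A (Suc r) = kronecker A (tensor_power A r)"

lemma tensor_power_carrier: "A \<in> carrier_mat n n \<Longrightarrow> tensor_power A r \<in> carrier_mat (n ^ r) (n ^ r)"
  by (induction r) (auto intro: kronecker_carrier)

lemma tensor_power_mult:
  assumes "A \<in> carrier_mat n n" "B \<in> carrier_mat n n"
  shows "tensor_power (A * B) r = tensor_power A r * tensor_power B r"
proof (induction r)
  case (Suc r)
  show ?case
    using assms by (simp add: Suc.IH kronecker_mult[of _ n _ _ "n ^ r"] tensor_power_carrier)
qed simp

lemma mat_trace_tensor_power:
  assumes "A \<in> carrier_mat n n"
  shows "mat_trace (tensor_power A r) = mat_trace A ^ r"
proof (induction r)
  case (Suc r)
  show ?case
    using assms by (simp add: Suc.IH mat_trace_kronecker[of _ n _ "n ^ r"] tensor_power_carrier)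
qed (simp add: mat_trace_one)

lemma subgroup_GL_carrier: "subgroup P (GL n) \<Longrightarrow> g \<in> P \<Longrightarrow> g \<in> carrier_mat n n"
  using subgroup.mem_carrier[of P "GL n" g] by (simp add: carrier_GL)

text \<open>
  The \<open>r\<close>-th power of the trace is the trace on the \<open>r\<close>-th tensor power, so \<open>c\<close> is the dimension of
  the space of invariant tensors. Right multiplication permutes the group, hence the sum of the
  tensor powers absorbs each of its summands.
\<close>

lemma card_dvd_sum_trace_power:
  assumes P: "subgroup P (GL n)" "finite P"
  obtains c :: nat where "(\<Sum>g\<in>P. mat_trace g ^ r) = of_nat (card P) * of_nat c"
proof -
  interpret GL: group "GL n" by (rule group_GL)
  note carr = subgroup_GL_carrier[OF P(1)]
  define \<rho> where "\<rho> g = tensor_power g r" for g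
  have \<rho>: "\<rho> g \<in> carrier_mat (n ^ r) (n ^ r)" if "g \<in> P" for g
    unfolding \<rho>_def by (rule tensor_power_carrier[OF carr[OF that]])
  have ne: "P \<noteq> {}" using subgroup.one_closed[OF P(1)] by auto
  have inv: "sum_mats (n ^ r) \<rho> P * \<rho> a = sum_mats (n ^ r) \<rho> P" if a: "a \<in> P" for a
  proof -
    have "inj_on (\<lambda>b. b * a) P"
      using GL.right_cancel subgroup.mem_carrier[OF P(1)] a by (auto simp: inj_on_def mult_GL)
    moreover have "(\<lambda>b. b * a) ` P \<subseteq> P"
      using subgroup.m_closed[OF P(1) _ a] by (auto simp: mult_GL)
    ultimately have bij: "bij_betw (\<lambda>b. b * a) P P"
      using endo_inj_surj[OF P(2)] by (auto simp: bij_betw_def)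
    have "sum_mats (n ^ r) \<rho> P * \<rho> a = sum_mats (n ^ r) (\<lambda>b. \<rho> b * \<rho> a) P"
      by (rule sum_mats_mult[OF \<rho>[OF a] \<rho>])
    also have "\<dots> = sum_mats (n ^ r) (\<lambda>b. \<rho> (b * a)) P"
      using carr a by (intro sum_mats_cong) (auto simp: \<rho>_def tensor_power_mult[of _ n])
    also have "\<dots> = sum_mats (n ^ r) \<rho> P" by (rule sum_mats_reindex[OF bij])
    finally show ?thesis .
  qed
  obtain c :: nat where "(\<Sum>g\<in>P. mat_trace (\<rho> g)) = of_nat (card P) * of_nat c"
    by (rule invariant_sum_mats_trace[OF P(2) ne \<rho> inv]) (assumption, assumption, rule that, assumption)
  then have "(\<Sum>g\<in>P. mat_trace g ^ r) = of_nat (card P) * of_nat c"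
    by (simp add: \<rho>_def mat_trace_tensor_power[OF carr])
  then show ?thesis by (rule that)
qed

section \<open>Linear independence of roots of unity of prime power order\<close>

abbreviation ipoly :: "int poly \<Rightarrow> complex \<Rightarrow> complex" where
  "ipoly f x \<equiv> poly (map_poly of_int f) x"

lemma prime_dvd_power_add_diff:
  fixes x y :: "'a :: comm_ring_1"
  assumes "prime p"
  shows "of_nat p dvd (x + y) ^ p - (x ^ p + y ^ p)"
proof -
  have p: "p > 0" using assms by (simp add: prime_gt_0_nat)
  have "(x + y) ^ p = (\<Sum>k\<le>p. of_nat (p choose k) * x ^ k * y ^ (p - k))"
    by (rule binomial_ring)
  also have "{..p} = insert 0 (insert p {0<..<p})" using p by auto
  also have "(\<Sum>k\<in>\<dots>. of_nat (p choose k) * x ^ k * y ^ (p - k)) =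
      x ^ p + y ^ p + (\<Sum>k\<in>{0<..<p}. of_nat (p choose k) * x ^ k * y ^ (p - k))"
    using p by (simp add: algebra_simps)
  finally have eq: "(x + y) ^ p - (x ^ p + y ^ p) =
      (\<Sum>k\<in>{0<..<p}. of_nat (p choose k) * x ^ k * y ^ (p - k))" by simp
  have "of_nat p dvd (of_nat (p choose k) :: 'a)" if "k \<in> {0<..<p}" for k
  proof -
    have "p dvd p choose k" using that assms p by (intro dvd_choose_prime) auto
    then obtain c where "p choose k = p * c" by (elim dvdE)
    then show ?thesis by simp
  qed
  then show ?thesis unfolding eq by (intro dvd_sum dvd_mult2) auto
qed

text \<open>
  Iterated Frobenius: taking \<open>p\<close>-th powers is additive modulo \<open>p\<close>.
\<close>

lemma prime_dvd_add_power_prime_power_diff: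
  fixes x y :: "'a :: comm_ring_1"
  assumes "prime p"
  shows "of_nat p dvd (x + y) ^ (p ^ k) - (x ^ (p ^ k) + y ^ (p ^ k))"
proof (induction k)
  case (Suc k)
  let ?P = "of_nat p :: 'a"
  from Suc obtain v where v: "(x + y) ^ (p ^ k) = x ^ (p ^ k) + y ^ (p ^ k) + ?P * v"
    by (auto simp: dvd_def algebra_simps)
  have e: "z ^ (p ^ Suc k) = (z ^ (p ^ k)) ^ p" for z :: 'a
    by (simp add: power_mult[symmetric] mult.commute)
  let ?u = "x ^ (p ^ k) + y ^ (p ^ k)"
  have "?P dvd (?u + ?P * v) ^ p - (?u ^ p + (?P * v) ^ p)"
    by (rule prime_dvd_power_add_diff[OF assms])
  moreover have "?P dvd (?P * v) ^ p"
    using prime_gt_0_nat[OF assms] by (intro dvd_trans[OF dvd_triv_left dvd_power]) auto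
  moreover have "?P dvd ?u ^ p - ((x ^ (p ^ k)) ^ p + (y ^ (p ^ k)) ^ p)"
    by (rule prime_dvd_power_add_diff[OF assms])
  ultimately have "?P dvd ((?u + ?P * v) ^ p - (?u ^ p + (?P * v) ^ p)) + (?P * v) ^ p
       + (?u ^ p - ((x ^ (p ^ k)) ^ p + (y ^ (p ^ k)) ^ p))"
    by (intro dvd_add)
  then show ?case unfolding e v by (simp add: algebra_simps)
qed simp

text \<open>
  Multiplication by \<open>ipoly w z\<close> maps the span of \<open>1, z, \<dots>, z ^ (q - 1)\<close> to itself with integer
  coefficients. The vector of these powers is therefore an eigenvector of an integer matrix, so
  \<open>ipoly w z\<close> is an algebraic integer, and rational algebraic integers are integers.
\<close>

lemma rational_ipoly_root_of_unity_Ints: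
  fixes z :: complex
  assumes z: "z ^ q = 1" and q: "q > 0" and rat: "ipoly w z \<in> \<rat>"
  shows "ipoly w z \<in> \<int>"
proof -
  define D where "D = degree w"
  \<comment> \<open>the matrix of multiplication by \<open>ipoly w z\<close> on the powers of \<open>z\<close>, exponents taken modulo \<open>q\<close>\<close>
  define A :: "int mat" where
    "A = mat q q (\<lambda>(i, j). \<Sum>k | k \<le> D \<and> (i + k) mod q = j. coeff w k)"
  define v :: "complex vec" where "v = vec q (\<lambda>j. z ^ j)"
  let ?A = "map_mat of_int A :: complex mat"
  have A: "A \<in> carrier_mat q q" "?A \<in> carrier_mat q q" by (auto simp: A_def)
  have zmod: "z ^ (k mod q) = z ^ k" for k
  proof -
    have "z ^ k = z ^ (k mod q + q * (k div q))" by simp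
    also have "\<dots> = z ^ (k mod q)" unfolding power_add power_mult z by simp
    finally show ?thesis ..
  qed
  have wz: "ipoly w z = (\<Sum>k\<le>D. of_int (coeff w k) * z ^ k)"
    unfolding D_def by (simp add: poly_altdef degree_map_poly coeff_map_poly)
  have "?A *\<^sub>v v = ipoly w z \<cdot>\<^sub>v v"
  proof (rule eq_vecI)
    fix i assume "i < dim_vec (ipoly w z \<cdot>\<^sub>v v)"
    then have i: "i < q" by (simp add: v_def)
    have "(?A *\<^sub>v v) $ i = (\<Sum>j<q. of_int (A $$ (i, j)) * z ^ j)"
      using A i by (simp add: v_def scalar_prod_def atLeast0LessThan)
    also have "\<dots> = (\<Sum>j<q. \<Sum>k | k \<in> {..D} \<and> (i + k) mod q = j. of_int (coeff w k) * z ^ (i + k))"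
    proof (intro sum.cong refl)
      fix j assume "j \<in> {..<q}"
      then have j: "j < q" by simp
      have "of_int (A $$ (i, j)) * z ^ j
          = (\<Sum>k | k \<in> {..D} \<and> (i + k) mod q = j. of_int (coeff w k) * z ^ j)"
        using i j by (simp add: A_def sum_distrib_right)
      also have "\<dots> = (\<Sum>k | k \<in> {..D} \<and> (i + k) mod q = j. of_int (coeff w k) * z ^ (i + k))"
        by (intro sum.cong refl) (auto simp: zmod)
      finally show "of_int (A $$ (i, j)) * z ^ j
          = (\<Sum>k | k \<in> {..D} \<and> (i + k) mod q = j. of_int (coeff w k) * z ^ (i + k))" .
    qed
    also have "\<dots> = (\<Sum>k\<le>D. of_int (coeff w k) * z ^ (i + k))"
      using q by (intro sum.group) auto
    also have "\<dots> = ipoly w z * z ^ i"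
      unfolding wz sum_distrib_right by (intro sum.cong refl) (simp add: power_add)
    finally show "(?A *\<^sub>v v) $ i = (ipoly w z \<cdot>\<^sub>v v) $ i"
      using i by (simp add: v_def)
  qed (use A in \<open>auto simp: v_def\<close>)
  moreover have "v \<noteq> 0\<^sub>v q"
  proof
    assume "v = 0\<^sub>v q"
    then have "v $ 0 = 0\<^sub>v q $ 0" by simp
    then show False using q by (simp add: v_def)
  qed
  ultimately have "eigenvalue ?A (ipoly w z)"
    unfolding eigenvalue_def eigenvector_def using A by (intro exI[of _ v]) (auto simp: v_def)
  then have "poly (char_poly ?A) (ipoly w z) = 0"
    using eigenvalue_root_char_poly[OF A(2)] by simp
  then have "poly (map_poly of_int (char_poly A)) (ipoly w z) = 0"
    by (simp add: of_int_hom.char_poly_hom[OF A(1)])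
  moreover have "lead_coeff (char_poly A) = 1"
    using degree_monic_char_poly[OF A(1)] by simp
  ultimately have "algebraic_int (ipoly w z)"
    unfolding algebraic_int_altdef_ipoly by blast
  then show ?thesis using rat by (rule rational_algebraic_int_is_int)
qed

lemma of_nat_dvd_poly_iff:
  fixes f :: "int poly"
  shows "of_nat p dvd f \<longleftrightarrow> (\<forall>i. int p dvd coeff f i)"
proof -
  have "(of_nat p :: int poly) = [:int p:]" by (simp add: of_nat_poly)
  then show ?thesis using const_poly_dvd_iff[of "int p" f] by simp
qed

lemma ipoly_simps [simp]:
  "ipoly (f + g) x = ipoly f x + ipoly g x"
  "ipoly (f - g) x = ipoly f x - ipoly g x"
  "ipoly (f * g) x = ipoly f x * ipoly g x"
  "ipoly (- f) x = - ipoly f x"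
  "ipoly (f ^ k) x = ipoly f x ^ k"
  "ipoly (of_nat n) x = of_nat n"
  "ipoly (of_int a) x = of_int a"
  "ipoly 1 x = 1"
  "ipoly (pCons a f) x = of_int a + x * ipoly f x"
  "ipoly (monom a n) x = of_int a * x ^ n"
  "ipoly (\<Sum>i\<in>I. h i) x = (\<Sum>i\<in>I. ipoly (h i) x)"
  by (simp_all add: hom_distribs poly_sum poly_monom)

lemma ipoly_pcompose: "ipoly (pcompose f g) x = ipoly f (ipoly g x)"
  by (induction f) (simp_all add: pcompose_pCons)

abbreviation indet :: "int poly" where "indet \<equiv> [:0, 1:]"

text \<open>
  The condition on \<open>z\<close> says that \<open>z\<close> is a root of the cyclotomic polynomial of order \<open>p * m\<close>, a
  power of \<open>p\<close>. Its degree is \<open>(p - 1) * m\<close>, and the lemmas below show that no nonzero integer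
  polynomial of smaller degree vanishes at \<open>z\<close>. As in Eisenstein's criterion, polynomials are
  expanded around \<open>1\<close>, that is, evaluated at \<open>z - 1\<close>, which generates the prime ideal above \<open>p\<close>.
\<close>

context
  fixes p m k :: nat and z :: complex
  assumes p: "prime p" and m: "m = p ^ k" and z: "(\<Sum>j<p. (z ^ m) ^ j) = 0"
begin

lemma root_of_cyclotomic_sum_power: "z ^ (p * m) = 1"
  using power_diff_1_eq[of "z ^ m" p] z by (simp add: power_mult[symmetric] mult.commute)

lemma root_of_cyclotomic_sum_neq_1: "z \<noteq> 1"
  using z prime_gt_0_nat[OF p] by auto

text \<open>
  Integers divisible by \<open>z - 1\<close> in \<open>\<int>[z]\<close> are divisible by \<open>p\<close>. If \<open>a\<close> is the constant coefficient,
  then \<open>a\<close> is a multiple of \<open>z - 1\<close>, and the Frobenius congruence together with \<open>z ^ (p * m) = 1\<close>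
  makes \<open>(z - 1) ^ (p * m)\<close> a multiple of \<open>p\<close>. So \<open>a ^ (p * m) / p\<close> is a rational number of the
  form \<open>ipoly w z\<close>, hence an integer.
\<close>

lemma prime_dvd_coeff_0_of_root:
  assumes f: "ipoly f (z - 1) = 0"
  shows "int p dvd coeff f 0"
proof -
  let ?q = "p * m"
  have q0: "?q > 0" using m prime_gt_0_nat[OF p] by simp
  have "of_nat p dvd (1 + indet) ^ ?q - (1 ^ ?q + indet ^ ?q)"
    using prime_dvd_add_power_prime_power_diff[OF p, of 1 indet "Suc k"] by (simp add: m)
  then obtain V where "(1 + indet) ^ ?q - (1 ^ ?q + indet ^ ?q) = of_nat p * V" by (elim dvdE)
  then have "ipoly ((1 + indet) ^ ?q - (1 ^ ?q + indet ^ ?q)) (z - 1) = ipoly (of_nat p * V) (z - 1)"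
    by simp
  then have V: "(z - 1) ^ ?q = - (of_nat p * ipoly V (z - 1))"
    unfolding ipoly_simps using root_of_cyclotomic_sum_power by (simp add: algebra_simps eq_neg_iff_add_eq_0)
  obtain a g where fg: "f = pCons a g" by (cases f) auto
  have a: "of_int a = - ((z - 1) * ipoly g (z - 1))"
    using f unfolding fg by (simp add: eq_neg_iff_add_eq_0)
  \<comment> \<open>\<open>a ^ q\<close> expressed through \<open>(z - 1) ^ q\<close>, with the factor \<open>p\<close> split off\<close>
  define W where "W = (- 1) ^ ?q * (- V) * g ^ ?q"
  have aW: "of_int a ^ ?q = of_nat p * ipoly W (z - 1)"
    unfolding a W_def power_minus[of "(z - 1) * _"] power_mult_distrib V by simp
  have Wz: "ipoly W (z - 1) = ipoly (pcompose W [:-1, 1:]) z"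
    unfolding ipoly_pcompose by simp
  have "ipoly W (z - 1) = of_int a ^ ?q / of_nat p"
    using aW prime_gt_0_nat[OF p] by simp
  then have "ipoly W (z - 1) \<in> \<rat>" by simp
  then have "ipoly W (z - 1) \<in> \<int>"
    unfolding Wz by (rule rational_ipoly_root_of_unity_Ints[OF root_of_cyclotomic_sum_power q0])
  then obtain b where "ipoly W (z - 1) = of_int b" by (elim Ints_cases)
  then have "(of_int (a ^ ?q) :: complex) = of_int (int p * b)" using aW by simp
  then have "a ^ ?q = int p * b" unfolding of_int_eq_iff .
  then have "int p dvd a ^ ?q" by simp
  then have "int p dvd a" using p by (metis prime_dvd_power prime_nat_int_transfer)
  then show ?thesis unfolding fg by simp
qed

text \<open>
  The cyclotomic polynomial shifted by \<open>1\<close> is of Eisenstein type. Modulo \<open>p\<close>, the geometric sum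
  identity and Frobenius reduce to \<open>X ^ m * E = X ^ (p * m)\<close>.
\<close>

lemma shifted_cyclotomic_coeffs:
  defines "E \<equiv> (\<Sum>j<p. ((1 + indet) ^ m) ^ j)"
  shows "coeff E 0 = int p" "\<And>i. 0 < i \<Longrightarrow> i < (p - 1) * m \<Longrightarrow> int p dvd coeff E i"
proof -
  have "coeff E 0 = poly E 0" by (simp add: poly_0_coeff_0)
  also have "\<dots> = int p" by (simp add: E_def poly_sum)
  finally show "coeff E 0 = int p" .
  fix i assume i: "0 < i" "i < (p - 1) * m"
  have "of_nat p dvd (1 + indet) ^ m - (1 ^ m + indet ^ m)"
    unfolding m by (rule prime_dvd_add_power_prime_power_diff[OF p])
  then obtain U where U: "(1 + indet) ^ m - (1 ^ m + indet ^ m) = of_nat p * U" by (elim dvdE)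
  have "of_nat p dvd (1 + indet) ^ (p * m) - (1 ^ (p * m) + indet ^ (p * m))"
    using prime_dvd_add_power_prime_power_diff[OF p, of 1 indet "Suc k"] by (simp add: m)
  then obtain V where V: "(1 + indet) ^ (p * m) - (1 ^ (p * m) + indet ^ (p * m)) = of_nat p * V"
    by (elim dvdE)
  have "((1 + indet) ^ m - 1) * E = (1 + indet) ^ (p * m) - 1"
    unfolding E_def using power_diff_1_eq[of "(1 + indet) ^ m" p]
    by (simp only: power_mult[symmetric] mult.commute)
  then have "(indet ^ m + of_nat p * U) * E = indet ^ (p * m) + of_nat p * V"
    using U V by (simp only: power_one) (simp only: algebra_simps)
  then have "indet ^ m * E = indet ^ (p * m) + of_nat p * (V - U * E)"
    by (simp add: algebra_simps)
  moreover have ym: "indet ^ j = monom 1 j" for j by (simp add: monom_altdef)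
  ultimately have "coeff (monom 1 m * E) (i + m) = coeff (monom 1 (p * m) + of_nat p * (V - U * E)) (i + m)"
    by simp
  moreover have "i + m < p * m" using i by (simp add: diff_mult_distrib)
  moreover have "int p dvd coeff (of_nat p * (V - U * E)) (i + m)"
    using of_nat_dvd_poly_iff[of p "of_nat p * (V - U * E)"] by simp
  ultimately show "int p dvd coeff E i"
    by (simp add: coeff_monom_mult)
qed

text \<open>
  Once the constant coefficient is known to be \<open>p * c\<close>, subtracting \<open>c\<close> times the Eisenstein
  polynomial \<open>E\<close> removes it, and dividing by the indeterminate gives another polynomial with the
  root \<open>z - 1\<close>. Modulo \<open>p\<close> this merely shifts the low coefficients of \<open>f\<close> down by one.
\<close>

lemma prime_dvd_coeff_of_root:
  assumes "ipoly f (z - 1) = 0" and "i < (p - 1) * m"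
  shows "int p dvd coeff f i"
  using assms
proof (induction i arbitrary: f)
  case 0
  then show ?case by (simp add: prime_dvd_coeff_0_of_root)
next
  case (Suc i)
  define E where "E = (\<Sum>j<p. ((1 + indet) ^ m) ^ j)"
  obtain b S where ES: "E = pCons b S" by (cases E) auto
  have b: "b = int p" using shifted_cyclotomic_coeffs(1) unfolding E_def[symmetric] ES by simp
  have S: "int p dvd coeff S i"
    using shifted_cyclotomic_coeffs(2)[of "Suc i"] Suc.prems unfolding E_def[symmetric] ES by simp
  have "ipoly E (z - 1) = 0" unfolding E_def ipoly_simps using z by simp
  then have pS: "of_nat p + (z - 1) * ipoly S (z - 1) = 0" unfolding ES b by simp
  obtain a g where fg: "f = pCons a g" by (cases f) auto
  from prime_dvd_coeff_0_of_root[OF Suc.prems(1)] obtain c where c: "a = int p * c"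
    unfolding fg by (auto elim: dvdE)
  have "(z - 1) * ipoly (g - of_int c * S) (z - 1)
      = ipoly f (z - 1) - of_int c * (of_nat p + (z - 1) * ipoly S (z - 1))"
    unfolding fg ipoly_simps by (simp add: c algebra_simps)
  also have "\<dots> = 0" using pS Suc.prems(1) by simp
  finally have "ipoly (g - of_int c * S) (z - 1) = 0"
    using root_of_cyclotomic_sum_neq_1 by simp
  then have "int p dvd coeff (g - of_int c * S) i"
    using Suc.prems by (intro Suc.IH) auto
  then have "int p dvd coeff (g - of_int c * S) i + c * coeff S i"
    using S by (intro dvd_add) auto
  then show ?case unfolding fg by (simp add: of_int_poly)
qed

text \<open>
  Below the degree of the cyclotomic polynomial all coefficients are divisible by \<open>p\<close>, and the
  quotient by \<open>p\<close> is again such a polynomial: infinite descent.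
\<close>

lemma low_degree_root_eq_0:
  assumes "ipoly f (z - 1) = 0" and "\<And>i. i \<ge> (p - 1) * m \<Longrightarrow> coeff f i = 0"
  shows "f = 0"
proof -
  have "int p ^ N dvd coeff f i" for N i
    using assms
  proof (induction N arbitrary: f)
    case (Suc N)
    have "int p dvd coeff f i" for i
      using Suc.prems prime_dvd_coeff_of_root by (cases "i < (p - 1) * m") auto
    then have "of_nat p dvd f" by (simp add: of_nat_dvd_poly_iff)
    then obtain g where g: "f = of_nat p * g" by (elim dvdE)
    have cg: "coeff f i = int p * coeff g i" for i
      unfolding g by (simp add: of_nat_poly)
    have "int p ^ N dvd coeff g i"
      using Suc.prems prime_gt_0_nat[OF p] cg by (intro Suc.IH) (auto simp: g)
    then show ?case unfolding cg by simp
  qed simp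
  moreover have "a = 0" if "\<And>N. int p ^ N dvd a" for a :: int
  proof (rule ccontr)
    assume a: "a \<noteq> 0"
    have "int p ^ nat \<bar>a\<bar> \<le> \<bar>a\<bar>" using dvd_imp_le_int[OF a that[of "nat \<bar>a\<bar>"]] by simp
    moreover have "nat \<bar>a\<bar> < p ^ nat \<bar>a\<bar>"
      using prime_gt_1_nat[OF p] by (intro power_gt_expt) auto
    then have "int (nat \<bar>a\<bar>) < int p ^ nat \<bar>a\<bar>" by (simp only: of_nat_power[symmetric] of_nat_less_iff)
    ultimately show False by simp
  qed
  ultimately show ?thesis by (intro poly_eqI) simp
qed

lemma cyclotomic_powers_independent:
  fixes B :: "nat \<Rightarrow> int"
  assumes "(\<Sum>i<(p - 1) * m. of_int (B i) * z ^ i) = 0" and "i < (p - 1) * m"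
  shows "B i = 0"
proof -
  let ?d = "(p - 1) * m"
  define f where "f = (\<Sum>i<?d. monom (B i) i)"
  have cf: "coeff f i = (if i < ?d then B i else 0)" for i
    unfolding f_def by (simp add: coeff_sum)
  have "ipoly f z = (\<Sum>i<?d. of_int (B i) * z ^ i)"
    unfolding f_def ipoly_simps by simp
  then have f0: "ipoly (pcompose f [:1, 1:]) (z - 1) = 0"
    unfolding ipoly_pcompose using assms(1) by simp
  have "0 < ?d" using assms(2) by linarith
  then have "degree f < ?d" unfolding f_def
    by (intro degree_sum_less) (auto intro: le_less_trans[OF degree_monom_le])
  then have "degree (pcompose f [:1, 1:]) < ?d" by (simp add: degree_pcompose)
  then have "pcompose f [:1, 1:] = 0"
    by (intro low_degree_root_eq_0 f0) (auto intro: coeff_eq_0)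
  then have "f = 0" by (subst (asm) pcompose_eq_0_iff) auto
  then show ?thesis using cf[of i] assms(2) by simp
qed

end

section \<open>Rational sums of roots of unity\<close>

text \<open>
  Eliminating the top \<open>m\<close> powers by \<open>z ^ d = - (\<Sum>l<p - 1. z ^ (l * m))\<close>, where
  \<open>d = (p - 1) * m\<close>, writes the sum in the independent powers below \<open>d\<close> with the coefficients
  \<open>c i - c (d + i mod m)\<close>. For a rational sum all of these vanish except the one at \<open>i = 0\<close>, which
  is the sum itself. So the \<open>p\<close> blocks of length \<open>m\<close> all agree with the last one apart from \<open>c 0\<close>, and
  \<open>j\<close> is the total of the last block.
\<close>

lemma rational_sum_of_roots_of_unity:
  fixes c :: "nat \<Rightarrow> nat" and z :: complex
  assumes p: "prime p" and m: "m = p ^ k" and z: "(\<Sum>j<p. (z ^ m) ^ j) = 0"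
    and rat: "(\<Sum>i<p * m. of_nat (c i) * z ^ i) \<in> \<rat>"
  obtains j :: nat where
    "(\<Sum>i<p * m. of_nat (c i) * z ^ i) = of_int (int (\<Sum>i<p * m. c i) - int p * int j)"
    "(p - 1) * j \<le> (\<Sum>i<p * m. c i)"
    "j = 0 \<Longrightarrow> \<forall>i. 0 < i \<longrightarrow> i < p * m \<longrightarrow> c i = 0"
proof -
  define t where "t = (\<Sum>i<p * m. of_nat (c i) * z ^ i)"
  define d where "d = (p - 1) * m"
  obtain s where s: "p = Suc s" "s > 0" using prime_gt_1_nat[OF p] by (cases p) auto
  have m0: "m > 0" using m prime_gt_0_nat[OF p] by simp
  have ds: "d = s * m" by (simp add: d_def s)
  have d0: "d > 0" using s m0 by (simp add: ds)
  obtain a b where b: "b > 0" and t: "t = of_int a / of_int b"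
    using rat unfolding t_def[symmetric] by (elim Rats_cases') auto
  \<comment> \<open>the coefficients after elimination, cleared of the denominator \<open>b\<close> of the sum\<close>
  define B where "B i = b * (int (c i) - int (c (d + i mod m))) - (if i = 0 then a else 0)" for i
  have split: "(\<Sum>i<p * m. f i) = (\<Sum>i<d. f i) + (\<Sum>r<m. f (d + r))"
    for f :: "nat \<Rightarrow> 'b :: comm_monoid_add"
    using sum_lessThan_mult[of f "Suc s" m] sum_lessThan_mult[of f s m]
    by (simp add: s ds del: mult_Suc)
  have zd: "(\<Sum>l<s. (z ^ m) ^ l) = - (z ^ d)"
    using z by (simp add: s ds power_mult[symmetric] mult.commute eq_neg_iff_add_eq_0)
  have "(\<Sum>i<d. of_nat (c (d + i mod m)) * z ^ i)
      = (\<Sum>l<s. \<Sum>r<m. of_nat (c (d + r)) * z ^ (l * m + r))"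
    unfolding ds sum_lessThan_mult by (intro sum.cong refl) simp
  also have "\<dots> = (\<Sum>r<m. of_nat (c (d + r)) * z ^ r * (\<Sum>l<s. (z ^ m) ^ l))"
    by (subst sum.swap)
      (simp add: sum_distrib_left power_add power_mult[symmetric] algebra_simps)
  also have "\<dots> = - (\<Sum>r<m. of_nat (c (d + r)) * z ^ (d + r))"
    unfolding zd by (simp add: sum_negf power_add algebra_simps)
  finally have low: "(\<Sum>i<d. of_nat (c (d + i mod m)) * z ^ i)
      = - (\<Sum>r<m. of_nat (c (d + r)) * z ^ (d + r))" .
  have "(\<Sum>i<d. of_int (B i) * z ^ i) = (\<Sum>i<d. of_int b * (of_nat (c i) * z ^ i)
      - of_int b * (of_nat (c (d + i mod m)) * z ^ i) - (if i = 0 then of_int a else 0))"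
    by (intro sum.cong refl) (simp add: B_def algebra_simps)
  also have "\<dots> = of_int b * t - of_int a"
    unfolding sum_subtractf sum_distrib_left[symmetric] low t_def split
    using d0 by (simp add: algebra_simps)
  also have "\<dots> = 0" using b by (simp add: t)
  finally have B0: "B i = 0" if "i < d" for i
    using cyclotomic_powers_independent[OF p m z, where B = B and i = i] that unfolding d_def by blast
  have ci: "c i = c (d + i mod m)" if "0 < i" "i < d" for i
    using B0[OF that(2)] that b by (simp add: B_def)
  have "b * (int (c 0) - int (c d)) = a" using B0[OF d0] by (simp add: B_def)
  then have t0: "t = of_int (int (c 0) - int (c d))" using b unfolding t by auto
  define j where "j = (\<Sum>r<m. c (d + r))"
  have block: "(\<Sum>r<m. c (l * m + r)) = j" if "0 < l" "l < s" for l
    unfolding j_def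
  proof (intro sum.cong refl)
    fix r assume r: "r \<in> {..<m}"
    have "l * m + r < Suc l * m" using r by simp
    also have "\<dots> \<le> d" unfolding ds using that by (intro mult_le_mono1) simp
    finally show "c (l * m + r) = c (d + r)" using ci[of "l * m + r"] that m0 r by simp
  qed
  \<comment> \<open>the first block, corrected for the exceptional value \<open>c 0\<close>\<close>
  have block0: "int (\<Sum>r<m. c r) = int j + (int (c 0) - int (c d))"
  proof -
    obtain m' where m': "m = Suc m'" using m0 by (cases m) auto
    have "(\<Sum>r<m'. c (Suc r)) = (\<Sum>r<m'. c (d + Suc r))"
    proof (intro sum.cong refl)
      fix r assume "r \<in> {..<m'}"
      then have r: "Suc r < m" by (simp add: m')
      also have "m \<le> d" using s by (simp add: ds)
      finally show "c (Suc r) = c (d + Suc r)" using ci[of "Suc r"] r by simp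
    qed
    then show ?thesis unfolding j_def m' sum.lessThan_Suc_shift by simp
  qed
  have total: "(\<Sum>i<p * m. c i) = (\<Sum>r<m. c r) + s * j"
  proof -
    obtain s' where s': "s = Suc s'" using s by (cases s) auto
    have "(\<Sum>i<d. c i) = (\<Sum>l<s. \<Sum>r<m. c (l * m + r))" unfolding ds sum_lessThan_mult ..
    also have "\<dots> = (\<Sum>r<m. c r) + (\<Sum>l<s'. \<Sum>r<m. c (Suc l * m + r))"
      unfolding s' sum.lessThan_Suc_shift by simp
    also have "(\<Sum>l<s'. \<Sum>r<m. c (Suc l * m + r)) = (\<Sum>l<s'. j)"
      using block[of "Suc _"] by (intro sum.cong refl) (simp add: s' del: mult_Suc)
    finally show ?thesis unfolding split j_def[symmetric] by (simp add: s')
  qed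
  have "t = of_int (int (\<Sum>i<p * m. c i) - int p * int j)"
  proof -
    have "int (c 0) - int (c d) = int (\<Sum>i<p * m. c i) - int p * int j"
      unfolding total using block0 by (simp add: s algebra_simps)
    then show ?thesis unfolding t0 by (simp only:)
  qed
  moreover have "(p - 1) * j \<le> (\<Sum>i<p * m. c i)" unfolding total by (simp add: s)
  moreover have "c i = 0" if j0: "j = 0" and i: "0 < i" "i < p * m" for i
  proof -
    have cd: "c (d + r) = 0" if "r < m" for r using j0 that by (simp add: j_def)
    show ?thesis
    proof (cases "i < d")
      case True
      then show ?thesis using ci[of i] cd[of "i mod m"] i m0 by simp
    next
      case False
      then show ?thesis using cd[of "i - d"] i by (simp add: ds s)
    qed
  qed
  ultimately show ?thesis unfolding t_def by (intro that) auto
qed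

section \<open>Matrices of finite order\<close>

lemma sum_root_of_unity:
  fixes w :: complex
  assumes "w ^ q = 1"
  shows "(\<Sum>i<q. w ^ i) = (if w = 1 then of_nat q else 0)"
  using assms power_diff_1_eq[of w q] by auto

lemma discrete_fourier_inversion:
  fixes x :: "nat \<Rightarrow> complex"
  assumes w: "w ^ q = 1" and prim: "\<And>k. 0 < k \<Longrightarrow> k < q \<Longrightarrow> w ^ k \<noteq> 1" and l: "l < q"
  shows "(\<Sum>i<q. w ^ (i * l) * (\<Sum>k<q. (1 / w ^ i) ^ k * x k)) = of_nat q * x l"
proof -
  have w0: "w \<noteq> 0" using w l by (auto simp: power_0_left)
  have one: "w ^ l / w ^ k = 1 \<longleftrightarrow> k = l" if "k < q" for k
  proof
    assume "w ^ l / w ^ k = 1"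
    then have eq: "w ^ l = w ^ k" using w0 by (simp add: field_simps)
    show "k = l"
    proof (rule ccontr)
      assume "k \<noteq> l"
      then consider "k < l" | "l < k" by linarith
      then show False
      proof cases
        case 1
        then have "w ^ (l - k) = 1" using eq w0 by (simp add: power_diff)
        then show False using prim[of "l - k"] 1 l by simp
      next
        case 2
        then have "w ^ (k - l) = 1" using eq w0 by (simp add: power_diff)
        then show False using prim[of "k - l"] 2 that by simp
      qed
    qed
  qed (use w0 in simp)
  have "(\<Sum>i<q. w ^ (i * l) * (\<Sum>k<q. (1 / w ^ i) ^ k * x k))
      = (\<Sum>i<q. \<Sum>k<q. (w ^ l / w ^ k) ^ i * x k)"
    unfolding sum_distrib_left
    by (intro sum.cong refl) (simp add: power_divide power_mult[symmetric] mult.commute)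
  also have "\<dots> = (\<Sum>k<q. (\<Sum>i<q. (w ^ l / w ^ k) ^ i) * x k)"
    by (subst sum.swap) (simp add: sum_distrib_right)
  also have "\<dots> = (\<Sum>k<q. if k = l then of_nat q * x k else 0)"
  proof (intro sum.cong refl)
    fix k assume "k \<in> {..<q}"
    moreover have "(w ^ l / w ^ k) ^ q = 1"
      unfolding power_divide power_mult[symmetric] mult.commute[of _ q] unfolding power_mult w by simp
    ultimately show "(\<Sum>i<q. (w ^ l / w ^ k) ^ i) * x k = (if k = l then of_nat q * x k else 0)"
      using one[of k] by (simp add: sum_root_of_unity)
  qed
  also have "\<dots> = of_nat q * x l" using l by simp
  finally show ?thesis .
qed

text \<open>
  The number \<open>c i\<close> is the dimension of the eigenspace for \<open>w ^ i\<close>. The projection onto this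
  eigenspace is the average of the powers of \<open>g / w ^ i\<close>, and Fourier inversion recovers \<open>g\<close> and its
  trace from the projections. In particular \<open>g\<close> is diagonalisable, which is why it must be the
  identity if all other eigenspaces vanish.
\<close>

lemma finite_order_mat_trace:
  assumes g: "g \<in> carrier_mat n n" and gq: "g ^\<^sub>m q = 1\<^sub>m n" and q: "1 < q"
    and w: "w ^ q = 1" and prim: "\<And>k. 0 < k \<Longrightarrow> k < q \<Longrightarrow> w ^ k \<noteq> 1"
  obtains c :: "nat \<Rightarrow> nat" where "n = (\<Sum>i<q. c i)" "mat_trace g = (\<Sum>i<q. of_nat (c i) * w ^ i)"
    and "\<forall>i. 0 < i \<longrightarrow> i < q \<longrightarrow> c i = 0 \<Longrightarrow> g = 1\<^sub>m n"
proof -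
  have q0: "q > 0" using q by simp
  \<comment> \<open>the powers of \<open>g / w ^ i\<close>, a matrix whose \<open>q\<close>-th power is again the identity\<close>
  define \<rho> where "\<rho> i k = (1 / w ^ i) ^ k \<cdot>\<^sub>m g ^\<^sub>m k" for i k
  define S where "S i = sum_mats n (\<rho> i) {..<q}" for i
  have \<rho>: "\<rho> i k \<in> carrier_mat n n" for i k using g by (simp add: \<rho>_def)
  have S: "S i \<in> carrier_mat n n" for i by (simp add: S_def)
  have \<rho>0: "\<rho> i 0 = 1\<^sub>m n" and \<rho>q: "\<rho> i q = 1\<^sub>m n" for i
  proof -
    have "(1 / w ^ i) ^ q = 1"
      unfolding power_divide power_mult[symmetric] mult.commute[of _ q] unfolding power_mult w by simp
    then show "\<rho> i q = 1\<^sub>m n" using gq by (auto simp: \<rho>_def)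
    show "\<rho> i 0 = 1\<^sub>m n" using g by (auto simp: \<rho>_def)
  qed
  have \<rho>Suc: "\<rho> i (Suc k) = \<rho> i k * \<rho> i 1" for i k
    using g by (simp add: \<rho>_def mult_smult_assoc_mat[of _ n n _ n] mult_smult_distrib[of _ n n _ n])
      (intro eq_matI, auto)
  have S1: "S i * \<rho> i 1 = S i" for i
  proof -
    have "S i * \<rho> i 1 = sum_mats n (\<lambda>k. \<rho> i (Suc k)) {..<q}"
      unfolding S_def \<rho>Suc by (rule sum_mats_mult[OF \<rho> \<rho>])
    also have "\<dots> = S i"
    proof -
      have "(\<Sum>k<q. \<rho> i (Suc k) $$ (a, b)) = (\<Sum>k<q. \<rho> i k $$ (a, b))" for a b
        using sum.lessThan_Suc_shift[of "\<lambda>k. \<rho> i k $$ (a, b)" q] by (simp add: \<rho>0 \<rho>q)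
      then show ?thesis unfolding S_def sum_mats_def by simp
    qed
    finally show ?thesis .
  qed
  have inv: "S i * \<rho> i k = S i" for i k
  proof (induction k)
    case 0
    show ?case unfolding \<rho>0 using S by (rule right_mult_one_mat)
  next
    case (Suc k)
    have "S i * \<rho> i (Suc k) = (S i * \<rho> i k) * \<rho> i 1"
      unfolding \<rho>Suc by (rule assoc_mult_mat[OF S \<rho> \<rho>, symmetric])
    then show ?case unfolding Suc S1 .
  qed
  have "\<exists>r::nat. (\<Sum>k<q. mat_trace (\<rho> i k)) = of_nat q * of_nat r \<and> (r = 0 \<longrightarrow> S i = 0\<^sub>m n n)" for i
    by (rule invariant_sum_mats_trace[of "{..<q}" "\<rho> i" n])
      (use q0 \<rho> inv in \<open>auto simp: S_def\<close>)
  then obtain c where c: "\<And>i. (\<Sum>k<q. mat_trace (\<rho> i k)) = of_nat q * of_nat (c i)"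
    and cS: "\<And>i. c i = 0 \<Longrightarrow> S i = 0\<^sub>m n n" by metis
  have tr: "mat_trace (g ^\<^sub>m l) = (\<Sum>i<q. of_nat (c i) * w ^ (i * l))" if l: "l < q" for l
  proof -
    have "of_nat q * mat_trace (g ^\<^sub>m l)
        = (\<Sum>i<q. w ^ (i * l) * (\<Sum>k<q. (1 / w ^ i) ^ k * mat_trace (g ^\<^sub>m k)))"
      using discrete_fourier_inversion[OF w prim l, of "\<lambda>k. mat_trace (g ^\<^sub>m k)"] by simp
    also have "\<dots> = (\<Sum>i<q. w ^ (i * l) * (of_nat q * of_nat (c i)))"
      unfolding c[symmetric] \<rho>_def using g by (simp add: mat_trace_smult[of _ n])
    also have "\<dots> = of_nat q * (\<Sum>i<q. of_nat (c i) * w ^ (i * l))"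
      by (simp add: sum_distrib_left algebra_simps)
    finally show ?thesis using q0 by simp
  qed
  have "(of_nat n :: complex) = of_nat (\<Sum>i<q. c i)"
    using tr[OF q0] g by (simp add: mat_trace_one)
  then have "n = (\<Sum>i<q. c i)" by (simp only: of_nat_eq_iff)
  moreover have "mat_trace g = (\<Sum>i<q. of_nat (c i) * w ^ i)"
    using tr[OF q] g by simp
  moreover have "g = 1\<^sub>m n" if c0: "\<forall>i. 0 < i \<longrightarrow> i < q \<longrightarrow> c i = 0"
  proof -
    have ent: "of_nat q * (g ^\<^sub>m l) $$ (a, b) = S 0 $$ (a, b)" if "l < q" "a < n" "b < n" for l a b
    proof -
      have "of_nat q * (g ^\<^sub>m l) $$ (a, b) = (\<Sum>i<q. w ^ (i * l) * S i $$ (a, b))"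
        using discrete_fourier_inversion[OF w prim that(1), of "\<lambda>k. (g ^\<^sub>m k) $$ (a, b)"] that g
        by (simp add: S_def sum_mats_def \<rho>_def)
      also have "\<dots> = (\<Sum>i<q. if i = 0 then S 0 $$ (a, b) else 0)"
      proof (intro sum.cong refl)
        fix i assume "i \<in> {..<q}"
        then have "i \<noteq> 0 \<Longrightarrow> S i = 0\<^sub>m n n" using cS[of i] c0 by simp
        then show "w ^ (i * l) * S i $$ (a, b) = (if i = 0 then S 0 $$ (a, b) else 0)"
          using that by simp
      qed
      finally show ?thesis using q0 by simp
    qed
    have "of_nat q * (g ^\<^sub>m 1) $$ (a, b) = of_nat q * (g ^\<^sub>m 0) $$ (a, b)" if "a < n" "b < n" for a b
      using ent[OF q that] ent[OF q0 that] by simp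
    then show ?thesis using g q0 by (intro eq_matI) auto
  qed
  ultimately show ?thesis by (rule that)
qed

lemma cis_root_of_unity_neq_1:
  assumes "0 < k" "k < q"
  shows "cis (2 * pi / real q) ^ k \<noteq> 1"
proof
  assume "cis (2 * pi / real q) ^ k = 1"
  then have eq: "cis (2 * pi * real k / real q) = cis (2 * pi * real 0 / real q)"
    by (simp add: DeMoivre mult.commute)
  have "inj_on (\<lambda>k. cis (2 * pi * real k / real q)) {..<q}"
    using bij_betw_roots_unity[of q] assms by (simp add: bij_betw_def)
  from inj_onD[OF this eq] have "k = 0" using assms by simp
  then show False using assms by simp
qed

lemma p_element_rational_trace:
  assumes p: "prime p" and a: "a > 0" and g: "g \<in> carrier_mat n n" and gq: "g ^\<^sub>m (p ^ a) = 1\<^sub>m n"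
    and rat: "mat_trace g \<in> \<rat>"
  obtains j where "mat_trace g = of_int (int n - int p * int j)" "j \<le> n div (p - 1)"
    "j = 0 \<Longrightarrow> g = 1\<^sub>m n"
proof -
  obtain k where k: "a = Suc k" using a by (cases a) auto
  define m where "m = p ^ k"
  have q: "p ^ a = p * m" by (simp add: k m_def)
  have q1: "1 < p * m" unfolding q[symmetric] using one_less_power[OF prime_gt_1_nat[OF p] a] .
  define w where "w = cis (2 * pi / real (p * m))"
  have prim: "w ^ i \<noteq> 1" if "0 < i" "i < p * m" for i
    unfolding w_def using cis_root_of_unity_neq_1[OF that] .
  have w: "w ^ (p * m) = 1" using q1 by (simp add: w_def DeMoivre)
  have "0 < m" using prime_gt_0_nat[OF p] by (simp add: m_def)
  moreover from this have "m < p * m" using prime_gt_1_nat[OF p] by simp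
  ultimately have "w ^ m \<noteq> 1" using prim by blast
  moreover have "(w ^ m) ^ p = 1" using w by (simp add: power_mult[symmetric] mult.commute)
  ultimately have z: "(\<Sum>j<p. (w ^ m) ^ j) = 0" by (simp add: sum_root_of_unity)
  obtain c where c: "n = (\<Sum>i<p * m. c i)" "mat_trace g = (\<Sum>i<p * m. of_nat (c i) * w ^ i)"
    "\<forall>i. 0 < i \<longrightarrow> i < p * m \<longrightarrow> c i = 0 \<Longrightarrow> g = 1\<^sub>m n"
    by (rule finite_order_mat_trace[OF g gq[unfolded q] q1 w]) (erule prim, assumption, rule that, assumption, assumption, blast)
  obtain j where j: "mat_trace g = of_int (int n - int p * int j)" "(p - 1) * j \<le> n"
    "j = 0 \<Longrightarrow> \<forall>i. 0 < i \<longrightarrow> i < p * m \<longrightarrow> c i = 0"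
    by (rule rational_sum_of_roots_of_unity[OF p m_def z rat[unfolded c(2)], folded c(1,2)]) (rule that, assumption, assumption, blast)
  have "j \<le> n div (p - 1)"
    using j(2) prime_gt_1_nat[OF p] by (simp add: less_eq_div_iff_mult_less_eq mult.commute)
  then show ?thesis using j c(3) by (intro that) auto
qed

section \<open>Finite p-groups of matrices\<close>

lemma card_dvd_sum_poly_trace:
  fixes f :: "int poly"
  assumes P: "subgroup P (GL n)" "finite P"
  obtains b :: int where "(\<Sum>g\<in>P. ipoly f (mat_trace g)) = of_int (int (card P) * b)"
proof -
  obtain c where c: "\<And>r. (\<Sum>g\<in>P. mat_trace g ^ r) = of_nat (card P) * of_nat (c r)"
  proof -
    have "\<exists>c::nat. (\<Sum>g\<in>P. mat_trace g ^ r) = of_nat (card P) * of_nat c" for r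
      by (rule card_dvd_sum_trace_power[OF P]) blast
    then show ?thesis using that by metis
  qed
  have "(\<Sum>g\<in>P. ipoly f (mat_trace g)) = (\<Sum>g\<in>P. \<Sum>r\<le>degree f. of_int (coeff f r) * mat_trace g ^ r)"
    by (simp add: poly_altdef degree_map_poly coeff_map_poly)
  also have "\<dots> = (\<Sum>r\<le>degree f. of_int (coeff f r) * (\<Sum>g\<in>P. mat_trace g ^ r))"
    by (subst sum.swap) (simp add: sum_distrib_left)
  also have "\<dots> = of_int (int (card P) * (\<Sum>r\<le>degree f. coeff f r * int (c r)))"
    unfolding c by (simp add: sum_distrib_left algebra_simps)
  finally show ?thesis by (rule that)
qed

lemma pow_GL: "A \<in> carrier_mat n n \<Longrightarrow> A [^]\<^bsub>GL n\<^esub> (k :: nat) = A ^\<^sub>m k"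
proof (induction k)
  case 0
  then have "dim_row A = n" by simp
  then show ?case unfolding nat_pow_0 pow_mat.simps one_GL by simp
next
  case (Suc k)
  from Suc.IH[OF Suc.prems] show ?case unfolding nat_pow_Suc pow_mat.simps mult_GL
    by (rule arg_cong)
qed

text \<open>
  The polynomial \<open>f\<close> has all the admissible traces \<open>n - p * j\<close> as roots except \<open>n\<close> itself, so that
  only the identity contributes to the sum of \<open>f (trace g)\<close> over the group.
\<close>

lemma card_p_subgroup_dvd:
  assumes p: "prime p" and P: "subgroup P (GL n)" "card P = p ^ a"
    and rat: "\<And>g. g \<in> P \<Longrightarrow> mat_trace g \<in> \<rat>"
  shows "p ^ a dvd p ^ (n div (p - 1)) * fact (n div (p - 1))"
proof (cases "a = 0")
  case False
  define N where "N = n div (p - 1)"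
  have fin: "finite P" using P(2) prime_gt_0_nat[OF p] by (intro card_ge_0_finite) simp
  interpret GL: group "GL n" by (rule group_GL)
  interpret P: group "GL n\<lparr>carrier := P\<rparr>" by (rule subgroup.subgroup_is_group[OF P(1) group_GL])
  note carr = subgroup_GL_carrier[OF P(1)]
  have one: "1\<^sub>m n \<in> P" using subgroup.one_closed[OF P(1)] by (simp add: one_GL)
  have gq: "g ^\<^sub>m (p ^ a) = 1\<^sub>m n" if g: "g \<in> P" for g
  proof -
    have "g [^]\<^bsub>GL n\<lparr>carrier := P\<rparr>\<^esub> p ^ a = \<one>\<^bsub>GL n\<lparr>carrier := P\<rparr>\<^esub>"
      using P.pow_order_eq_1[of g] g P(2) by (simp add: Coset.order_def)
    then have "g [^]\<^bsub>GL n\<^esub> p ^ a = \<one>\<^bsub>GL n\<^esub>" by (simp add: nat_pow_def)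
    then show ?thesis unfolding pow_GL[OF carr[OF g]] one_GL .
  qed
  obtain J where J: "\<And>g. g \<in> P \<Longrightarrow> mat_trace g = of_int (int n - int p * int (J g))"
    "\<And>g. g \<in> P \<Longrightarrow> J g \<le> N" "\<And>g. g \<in> P \<Longrightarrow> J g = 0 \<Longrightarrow> g = 1\<^sub>m n"
  proof -
    have "\<exists>j. mat_trace g = of_int (int n - int p * int j) \<and> j \<le> N \<and> (j = 0 \<longrightarrow> g = 1\<^sub>m n)"
      if g: "g \<in> P" for g
      by (rule p_element_rational_trace[OF p _ carr[OF g] gq[OF g] rat[OF g]])
        (use False in \<open>auto simp: N_def\<close>)
    then show ?thesis using that by metis
  qed
  define f :: "int poly" where "f = (\<Prod>j\<in>{1..N}. [:- (int n - int p * int j), 1:])"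
  have f: "ipoly f (of_int x) = of_int (\<Prod>j\<in>{1..N}. x - (int n - int p * int j))" for x
    unfolding f_def by (simp add: hom_distribs poly_prod algebra_simps)
  have "ipoly f (mat_trace g) = (if g = 1\<^sub>m n then of_nat (p ^ N * fact N) else 0)" if g: "g \<in> P" for g
  proof (cases "g = 1\<^sub>m n")
    case True
    have "mat_trace g = of_int (int n)" using True by (simp add: mat_trace_one)
    moreover have "(\<Prod>j\<in>{1..N}. int n - (int n - int p * int j)) = int (p ^ N * fact N)"
      by (simp add: prod.distrib fact_prod)
    ultimately show ?thesis using True by (simp only: f) simp
  next
    case False
    then have "J g \<in> {1..N}" using J(2,3)[OF g] by (cases "J g") auto
    then have "(\<Prod>j\<in>{1..N}. (int n - int p * int (J g)) - (int n - int p * int j)) = 0"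
      by (intro prod_zero) auto
    then show ?thesis using False unfolding J(1)[OF g] f by simp
  qed
  then have "(\<Sum>g\<in>P. ipoly f (mat_trace g)) = of_nat (p ^ N * fact N)"
    using fin one by (simp add: sum.delta)
  moreover obtain b where "(\<Sum>g\<in>P. ipoly f (mat_trace g)) = of_int (int (card P) * b)"
    using card_dvd_sum_poly_trace[OF P(1) fin] .
  ultimately have "(of_int (int (p ^ N * fact N)) :: complex) = of_int (int (card P) * b)"
    by simp
  then have "int (p ^ N * fact N) = int (p ^ a) * b" unfolding of_int_eq_iff P(2) .
  then have "int (p ^ a) dvd int (p ^ N * fact N)" by simp
  then show ?thesis unfolding N_def of_nat_dvd_iff .
qed simp

section \<open>The exponent of a prime in the bound\<close>

text \<open>
  Legendre's formula. The summation range is fixed by \<open>n\<close> rather than by \<open>N\<close>, which keeps it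
  unchanged in the induction; the additional terms are zero.
\<close>

lemma multiplicity_fact:
  assumes p: "prime p" and "N \<le> n"
  shows "multiplicity p (fact N) = (\<Sum>k\<in>{1..<n}. N div p ^ k)"
  using assms(2)
proof (induction N)
  case (Suc N)
  have pw: "k < p ^ k" for k using prime_gt_1_nat[OF p] by (intro power_gt_expt) auto
  have "{k \<in> {1..<n}. p ^ k dvd Suc N} = {1..multiplicity p (Suc N)}"
  proof (intro equalityI subsetI)
    fix k assume k: "k \<in> {1..multiplicity p (Suc N)}"
    then have d: "p ^ k dvd Suc N" by (intro multiplicity_dvd') auto
    then have "p ^ k \<le> n" using dvd_imp_le[OF d] Suc.prems by simp
    then have "k < n" using pw[of k] by simp
    then show "k \<in> {k \<in> {1..<n}. p ^ k dvd Suc N}" using k d by simp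
  next
    fix k assume "k \<in> {k \<in> {1..<n}. p ^ k dvd Suc N}"
    then show "k \<in> {1..multiplicity p (Suc N)}"
      using prime_gt_1_nat[OF p] by (auto intro!: multiplicity_geI)
  qed
  then have m: "multiplicity p (Suc N) = (\<Sum>k\<in>{1..<n}. if p ^ k dvd Suc N then 1 else 0)"
    by (simp add: sum.If_cases Int_def)
  have "multiplicity p (fact (Suc N)) = multiplicity p (Suc N * fact N)" by simp
  also have "\<dots> = multiplicity p (Suc N) + multiplicity p (fact N)"
    using p by (intro prime_elem_multiplicity_mult_distrib) auto
  also have "\<dots> = (\<Sum>k\<in>{1..<n}. (if p ^ k dvd Suc N then 1 else 0) + N div p ^ k)"
    using Suc unfolding m by (simp add: sum.distrib)
  also have "\<dots> = (\<Sum>k\<in>{1..<n}. Suc N div p ^ k)"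
    by (intro sum.cong refl) (auto simp: div_Suc dvd_eq_mod_eq_0)
  finally show ?case .
qed simp

lemma multiplicity_schur_exponent:
  assumes p: "prime p"
  shows "multiplicity p (p ^ (n div (p - 1)) * fact (n div (p - 1))) = schur_exponent n p"
proof (cases "n = 0")
  case False
  define N where "N = n div (p - 1)"
  have "multiplicity p (p ^ N * fact N) = N + multiplicity p (fact N)"
    using p by (subst prime_elem_multiplicity_mult_distrib) (auto simp: prime_gt_0_nat)
  also have "multiplicity p (fact N) = (\<Sum>k\<in>{1..<n}. N div p ^ k)"
    by (intro multiplicity_fact p) (simp add: N_def)
  also have "N + \<dots> = (\<Sum>k<n. N div p ^ k)"
    using False by (simp add: atLeast0LessThan[symmetric] sum.atLeast_Suc_lessThan[of 0])
  also have "\<dots> = schur_exponent n p"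
    unfolding schur_exponent_finite(2)[OF p] N_def by (simp add: div_mult2_eq[symmetric] mult.commute)
  finally show ?thesis unfolding N_def .
qed (use schur_exponent_finite(2)[OF p, of 0] in simp)

section \<open>Schur's theorem\<close>

theorem theorem2:
  fixes n :: nat and G :: "complex mat set"
  assumes "n > 0"
    and "subgroup G (GL n)"
    and "finite G"
    and "\<And>g. g \<in> G \<Longrightarrow> mat_trace g \<in> \<rat>"
  shows "card G dvd schur_bound n"
proof (rule multiplicity_le_imp_dvd)
  interpret GL: group "GL n" by (rule group_GL)
  have "G \<noteq> {}" using subgroup.one_closed[OF assms(2)] by auto
  then have card0: "card G \<noteq> 0" using assms(3) by simp
  then show "card G \<noteq> 0" .
  fix p :: nat assume p: "prime p"
  define a where "a = multiplicity p (card G)"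
  have "p ^ a dvd card G" unfolding a_def by (rule multiplicity_dvd)
  then obtain m where m: "card G = p ^ a * m" by (elim dvdE)
  have grp: "group (GL n\<lparr>carrier := G\<rparr>)"
    by (rule subgroup.subgroup_is_group[OF assms(2) group_GL])
  have "\<exists>P. subgroup P (GL n\<lparr>carrier := G\<rparr>) \<and> card P = p ^ a"
    using assms(3) m by (intro sylow_thm[OF p grp, where m = m]) (auto simp: Coset.order_def)
  then obtain P where P: "subgroup P (GL n\<lparr>carrier := G\<rparr>)" "card P = p ^ a" by blast
  have "P \<subseteq> G" using subgroup.subset[OF P(1)] by simp
  moreover have "subgroup P (GL n)" using GL.incl_subgroup[OF assms(2) P(1)] .
  ultimately have "p ^ a dvd p ^ (n div (p - 1)) * fact (n div (p - 1))"
    using assms(4) by (intro card_p_subgroup_dvd[OF p _ P(2)]) auto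
  then have "a \<le> multiplicity p (p ^ (n div (p - 1)) * fact (n div (p - 1)))"
    using p prime_gt_0_nat[OF p] by (intro multiplicity_geI) auto
  then have le: "a \<le> schur_exponent n p" unfolding multiplicity_schur_exponent[OF p] .
  have "p ^ a dvd schur_bound n"
  proof (cases "p \<le> n + 1")
    case True
    have "p ^ a dvd p ^ schur_exponent n p" by (rule le_imp_power_dvd[OF le])
    also have "\<dots> dvd schur_bound n"
      unfolding schur_bound_def using p True by (intro dvd_prodI) auto
    finally show ?thesis .
  next
    case False
    then have "a = 0" using le schur_exponent_eq_0[of n p] by simp
    then show ?thesis by simp
  qed
  moreover have "schur_bound n \<noteq> 0"
    unfolding schur_bound_def by (auto simp: prime_gt_0_nat)
  ultimately show "multiplicity p (card G) \<le> multiplicity p (schur_bound n)"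
    unfolding a_def[symmetric] using p by (intro multiplicity_geI) auto
qed

end
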